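(* For $\boldsymbol\theta=(\delta,\alpha,p)$ with $\delta>0$, $\alpha\in(0,1]$ and $p\in(0,1)$, let $f_{\boldsymbol\theta}$ be the generalized spectrum of the strictly stationary integer-valued AR(1) process $Z_t=p\circ Z_{t-1}+\epsilon_t$, $t\in\mathbb Z$, where $\{\epsilon_t\}$ is i.i.d. discrete stable with scale parameter $\delta$ and exponent $\alpha$. Then $\boldsymbol\theta$ is identifiable from the generalized spectrum: if $\boldsymbol\theta$ and $\boldsymbol\theta'$ are two such parameters with $f_{\boldsymbol\theta}(\lambda;u,v)=f_{\boldsymbol\theta'}(\lambda;u,v)$ for all $\lambda\in[0,2\pi]$ and $(u,v)\in[-\pi,\pi]^2$, then $\boldsymbol\theta=\boldsymbol\theta'$.
   Context: The generalized spectrum of a strictly stationary process $\{Z_t\}$ is $$f(\lambda;u,v)=\frac1{2\pi}\sum_{\ell=-\infty}^\infty\bigl\{{\rm E}(e^{iuZ_{t+\ell}+ivZ_t})-{\rm E}(e^{iuZ_{t+\ell}}){\rm E}(e^{ivZ_t})\bigr\}e^{-i\ell\lambda},\quad\lambda\in\mathbb R,\ (u,v)\in\mathbb R^2.$$ A nonnegative integer-valued random variable $W$ is discrete stable with scale parameter $\delta>0$ and exponent $\alpha\in(0,1]$ if ${\rm E}(x^W)=\exp\{-\delta(1-x)^\alpha\}$ for complex $x$ with $|x|\le1$ (principal branch). Binomial thinning: $p\circ Z_{t-1}=\sum_{i=1}^{Z_{t-1}}Y_{i,t-1}$ (equal to $0$ if $Z_{t-1}=0$), where the $Y_{i,t}$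 are i.i.d. (in $i$ and $t$) Bernoulli variables with parameter $p$; the array $\{Y_{i,t}\}$ is independent of $\{\epsilon_t\}$, and $\epsilon_t$ and $\{Y_{i,t-1}\}_i$ are independent of $(Z_s)_{s\le t-1}$. For $p\in(0,1)$ the strictly stationary solution is unique in law. *)

theory Defs
  imports "HOL-Probability.Probability"
begin

text \<open>
  The reference time is 0; for a strictly stationary process the choice is irrelevant.
  \<^const>\<open>infsum\<close> sums unconditionally over the integers and returns 0 for families that
  are not summable.
\<close>

definition generalized_spectrum ::
  "'a measure \<Rightarrow> (int \<Rightarrow> 'a \<Rightarrow> real) \<Rightarrow> real \<Rightarrow> real \<Rightarrow> real \<Rightarrow> complex" where
  "generalized_spectrum M Z lam u v =
     1 / (2 * of_real pi) *
     (\<Sum>\<^sub>\<infinity>l\<in>(UNIV :: int set).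
        ((LINT w|M. exp (\<i> * of_real u * of_real (Z l w) + \<i> * of_real v * of_real (Z 0 w)))
          - (LINT w|M. exp (\<i> * of_real u * of_real (Z l w)))
            * (LINT w|M. exp (\<i> * of_real v * of_real (Z 0 w))))
        * exp (- \<i> * of_int l * of_real lam))"

definition strictly_stationary ::
  "'a measure \<Rightarrow> 'b measure \<Rightarrow> (int \<Rightarrow> 'a \<Rightarrow> 'b) \<Rightarrow> bool" where
  "strictly_stationary M N Z \<longleftrightarrow>
     (\<forall>t. Z t \<in> measurable M N) \<and>
     (\<forall>J h. finite J \<longrightarrow>
        distr M (\<Pi>\<^sub>M t\<in>J. N) (\<lambda>w. \<lambda>t\<in>J. Z (t + h) w)
        = distr M (\<Pi>\<^sub>M t\<in>J. N) (\<lambda>w. \<lambda>t\<in>J. Z t w))"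

text \<open>
  The library's \<open>indep_var\<close> requires both variables to have the same value type;
  this is the same notion for two value types.
\<close>

definition indep_rvs ::
  "'a measure \<Rightarrow> 'b measure \<Rightarrow> ('a \<Rightarrow> 'b) \<Rightarrow> 'c measure \<Rightarrow> ('a \<Rightarrow> 'c) \<Rightarrow> bool" where
  "indep_rvs M N1 X1 N2 X2 \<longleftrightarrow>
     X1 \<in> measurable M N1 \<and> X2 \<in> measurable M N2 \<and>
     prob_space.indep_set M
       {X1 -` A \<inter> space M | A. A \<in> sets N1}
       {X2 -` A \<inter> space M | A. A \<in> sets N2}"

definition iid_vars ::
  "'a measure \<Rightarrow> 'b measure \<Rightarrow> ('i \<Rightarrow> 'a \<Rightarrow> 'b) \<Rightarrow> 'i set \<Rightarrow> bool" where
  "iid_vars M N X I \<longleftrightarrow>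
     prob_space.indep_vars M (\<lambda>_. N) X I \<and>
     (\<forall>i\<in>I. \<forall>j\<in>I. distr M N (X i) = distr M N (X j))"

text \<open>
  Complex \<open>powr\<close> is the principal branch with \<open>0 powr a = 0\<close>, and
  \<open>1 - x\<close> lies in the closed right half plane when \<open>norm x \<le> 1\<close>.
\<close>

definition discrete_stable :: "'a measure \<Rightarrow> ('a \<Rightarrow> nat) \<Rightarrow> real \<Rightarrow> real \<Rightarrow> bool" where
  "discrete_stable M W \<delta> \<alpha> \<longleftrightarrow>
     W \<in> measurable M (count_space UNIV) \<and>
     (\<forall>x::complex. norm x \<le> 1 \<longrightarrow>
        (LINT w|M. x ^ W w) = exp (- of_real \<delta> * (1 - x) powr of_real \<alpha>))"

definition thinning :: "(nat \<Rightarrow> 'a \<Rightarrow> nat) \<Rightarrow> ('a \<Rightarrow> nat) \<Rightarrow> 'a \<Rightarrow> nat" where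
  "thinning Y X w = (\<Sum>i=1..X w. Y i w)"

text \<open>
  The thinning variables \<open>Y i t\<close> are indexed by \<open>i \<ge> 1\<close>. In \<open>indep_past\<close> the innovation
  and the thinning variables are jointly independent of the past of the process.
\<close>

locale stationary_inar1 = prob_space M
  for M :: "'a measure" +
  fixes \<delta> \<alpha> p :: real
    and Z :: "int \<Rightarrow> 'a \<Rightarrow> nat"
    and Y :: "nat \<Rightarrow> int \<Rightarrow> 'a \<Rightarrow> nat"
    and \<epsilon> :: "int \<Rightarrow> 'a \<Rightarrow> nat"
  assumes stationary: "strictly_stationary M (count_space UNIV) Z"
    and recursion: "\<And>t. AE w in M. Z t w = thinning (\<lambda>i. Y i (t - 1)) (Z (t - 1)) w + \<epsilon> t w"
    and iid_innovations: "iid_vars M (count_space UNIV) \<epsilon> UNIV"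
    and stable_innovations: "\<And>t. discrete_stable M (\<epsilon> t) \<delta> \<alpha>"
    and iid_thinning: "iid_vars M (count_space UNIV) (\<lambda>(i, t). Y i t) ({1..} \<times> UNIV)"
    and bernoulli_thinning: "\<And>i t. i \<ge> 1 \<Longrightarrow>
          distr M (count_space UNIV) (Y i t) = measure_pmf (map_pmf of_bool (bernoulli_pmf p))"
    and indep_thinning_innovations:
          "indep_rvs M
             (\<Pi>\<^sub>M _\<in>{1..} \<times> UNIV. count_space UNIV) (\<lambda>w. \<lambda>(i, t)\<in>{1..} \<times> UNIV. Y i t w)
             (\<Pi>\<^sub>M _\<in>UNIV. count_space UNIV) (\<lambda>w t. \<epsilon> t w)"
    and indep_past: "\<And>t.
          indep_rvs M
             (count_space UNIV \<Otimes>\<^sub>M (\<Pi>\<^sub>M _\<in>{1..}. count_space UNIV))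
             (\<lambda>w. (\<epsilon> t w, \<lambda>i\<in>{1..}. Y i (t - 1) w))
             (\<Pi>\<^sub>M _\<in>{..t - 1}. count_space UNIV) (\<lambda>w. \<lambda>s\<in>{..t - 1}. Z s w)"

end

theory Submission
  imports Defs
begin

text \<open>
  Write \<open>\<rho> = p powr \<alpha>\<close> and \<open>\<kappa> = \<delta> / (1 - \<rho>)\<close>. Thinning turns the generating function variable
  \<open>x\<close> into \<open>1 - p (1 - x)\<close>, so that \<open>1 - x\<close> is scaled by \<open>p\<close> and \<open>(1 - x) powr \<alpha>\<close> by \<open>\<rho>\<close>. Running the
  recursion over \<open>l\<close> steps (\<open>one_step_pgf\<close>, \<open>joint_pgf_reduction\<close>) therefore produces geometric sums,
  and letting \<open>l\<close> tend to infinity shows that the stationary law is discrete stable with scale \<open>\<kappa>\<close> and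
  exponent \<open>\<alpha>\<close> (\<open>expectation_pgf\<close>). Both together give the generating function of \<open>(Z l, Z 0)\<close> and hence
  all generalized autocovariances in closed form.

  For fixed \<open>(u, v)\<close> the spectrum is a Fourier series in the frequency whose coefficients are, up to a constant factor, these
  autocovariances. They decay geometrically when \<open>cis u\<close> and \<open>cis v\<close> differ from \<open>1\<close>
  (\<open>summable_autocovariance\<close>), so the spectrum determines each of them
  (\<open>generalized_autocovariance_eqI\<close>).

  Three of them suffice. Lag \<open>0\<close> at \<open>(\<pi>, \<pi>)\<close> gives \<open>\<kappa> * 2 powr \<alpha>\<close>. Lag \<open>0\<close> at \<open>(\<pi>/3, -\<pi>/3)\<close>, where
  \<open>1 - x\<close> is the unit vector \<open>cis (-\<pi>/3)\<close>, gives \<open>\<kappa> * cos (\<alpha> * \<pi>/3)\<close>. The quotient is strictly monotone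
  in \<open>\<alpha>\<close>, which yields \<open>\<alpha>\<close> and then \<open>\<kappa>\<close>. Lag \<open>1\<close> at \<open>(\<pi>, \<pi>)\<close> now gives
  \<open>(1 - p) powr \<alpha> - p powr \<alpha>\<close>, which is strictly decreasing in \<open>p\<close>. Finally \<open>\<delta> = \<kappa> * (1 - \<rho>)\<close>.
\<close>

section \<open>Independence and expectations\<close>

text \<open>
  After composition with \<open>f\<close> and \<open>g\<close> the value types may agree, which makes the product rule for
  expectations available for pairs that started out with different value types.
\<close>

lemma (in prob_space) indep_rvs_imp_indep_var:
  assumes "indep_rvs M N1 X1 N2 X2" "f \<in> measurable N1 K" "g \<in> measurable N2 L"
  shows "indep_var K (\<lambda>w. f (X1 w)) L (\<lambda>w. g (X2 w))"
proof -
  have X: "X1 \<in> measurable M N1" "X2 \<in> measurable M N2"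
    and ind: "indep_set {X1 -` A \<inter> space M | A. A \<in> sets N1} {X2 -` A \<inter> space M | A. A \<in> sets N2}"
    using assms(1) by (auto simp: indep_rvs_def)
  have sub: "sigma_sets (space M) {(\<lambda>w. h (X w)) -` A \<inter> space M | A. A \<in> sets K'}
      \<subseteq> {X -` A \<inter> space M | A. A \<in> sets N}"
    if "X \<in> measurable M N" "h \<in> measurable N K'" for X :: "'a \<Rightarrow> 'x" and N and h :: "'x \<Rightarrow> 'y" and K'
  proof -
    have "sigma_sets (space M) {(\<lambda>w. h (X w)) -` A \<inter> space M | A. A \<in> sets K'}
        = {(\<lambda>w. h (X w)) -` A \<inter> space M | A. A \<in> sets K'}"
      using sigma_sets_vimage_commute[of "\<lambda>w. h (X w)" "space M" "space K'" "sets K'"]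
        measurable_space[OF measurable_compose[OF that]]
      by (simp add: sets.sigma_sets_eq)
    also have "\<dots> \<subseteq> {X -` A \<inter> space M | A. A \<in> sets N}"
    proof safe
      fix A assume "A \<in> sets K'"
      then have "h -` A \<inter> space N \<in> sets N" using that(2) by (rule measurable_sets[rotated])
      moreover have "(\<lambda>w. h (X w)) -` A \<inter> space M = X -` (h -` A \<inter> space N) \<inter> space M"
        using measurable_space[OF that(1)] by auto
      ultimately show "\<exists>B. (\<lambda>w. h (X w)) -` A \<inter> space M = X -` B \<inter> space M \<and> B \<in> sets N"
        by blast
    qed
    finally show ?thesis .
  qed
  have "indep_set (sigma_sets (space M) {(\<lambda>w. f (X1 w)) -` A \<inter> space M | A. A \<in> sets K})
      (sigma_sets (space M) {(\<lambda>w. g (X2 w)) -` A \<inter> space M | A. A \<in> sets L})"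
    using ind unfolding indep_set_def
    by (rule indep_sets_mono_sets)
      (use sub[OF X(1) assms(2)] sub[OF X(2) assms(3)] in \<open>simp split: bool.split\<close>)
  then show ?thesis
    using X assms(2,3) by (simp add: indep_var_eq measurable_compose[OF X(1)] measurable_compose[OF X(2)])
qed

lemma (in prob_space) indep_rvs_expectation_mult:
  fixes f :: "'b \<Rightarrow> complex" and g :: "'c \<Rightarrow> complex"
  assumes "indep_rvs M N1 X1 N2 X2" "f \<in> borel_measurable N1" "g \<in> borel_measurable N2"
    and "\<And>v. norm (f v) \<le> 1" "\<And>v. norm (g v) \<le> 1"
  shows "(LINT w|M. f (X1 w) * g (X2 w)) = (LINT w|M. f (X1 w)) * (LINT w|M. g (X2 w))"
proof -
  have [measurable]: "X1 \<in> measurable M N1" "X2 \<in> measurable M N2"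
    using assms(1) by (auto simp: indep_rvs_def)
  note [measurable] = assms(2,3)
  show ?thesis
    by (intro indep_var_lebesgue_integral indep_rvs_imp_indep_var[OF assms(1-3)]
        integrable_const_bound[of _ 1]) (use assms(4,5) in auto)
qed

text \<open>
  Conditioning on the integer \<open>N\<close> without conditional expectations: an identity between expectations
  need only be checked on each event \<open>N = n\<close>. This is dominated convergence for the partial sums.
\<close>

lemma (in prob_space) expectation_sums_over_values:
  fixes f :: "'a \<Rightarrow> complex" and N :: "'a \<Rightarrow> nat"
  assumes [measurable]: "N \<in> measurable M (count_space UNIV)" "f \<in> borel_measurable M"
    and bound: "\<And>w. norm (f w) \<le> 1"
  shows "(\<lambda>n. LINT w|M. of_bool (N w = n) * f w) sums (LINT w|M. f w)"
proof -
  have int: "integrable M (\<lambda>w. of_bool (N w = n) * f w)" for n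
    by (rule integrable_const_bound[of _ 1]) (use bound in \<open>auto simp: norm_mult\<close>)
  have part: "(\<Sum>n<m. of_bool (N w = n) * f w) = of_bool (N w < m) * f w" for m w
    by (subst sum_distrib_right[symmetric]) (simp add: of_bool_def sum.delta)
  have "(\<lambda>m. LINT w|M. (\<Sum>n<m. of_bool (N w = n) * f w)) \<longlonglongrightarrow> (LINT w|M. f w)"
  proof (rule integral_dominated_convergence[where w = "\<lambda>_. 1"])
    show "AE w in M. (\<lambda>m. \<Sum>n<m. of_bool (N w = n) * f w) \<longlonglongrightarrow> f w"
    proof (rule AE_I2)
      fix w
      show "(\<lambda>m. \<Sum>n<m. of_bool (N w = n) * f w) \<longlonglongrightarrow> f w"
        by (rule tendsto_eventually) (use eventually_gt_at_top[of "N w"] in eventually_elim, simp add: part)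
    qed
    show "AE w in M. norm (\<Sum>n<m. of_bool (N w = n) * f w) \<le> 1" for m
      using bound by (auto simp: part norm_mult)
  qed auto
  then show ?thesis
    unfolding sums_def Bochner_Integration.integral_sum[OF int] .
qed

lemma norm_affine_towards_1:
  fixes x :: complex
  assumes r: "0 \<le> r" "r \<le> 1" and x: "norm x \<le> 1"
  shows "norm (1 - of_real r * (1 - x)) \<le> 1"
proof -
  have "norm (1 - of_real r * (1 - x)) = norm ((1 - r) *\<^sub>R 1 + r *\<^sub>R x)"
    by (simp add: scaleR_conv_of_real algebra_simps)
  also have "\<dots> \<le> (1 - r) * 1 + r * 1"
    using r x by (intro norm_triangle_le add_mono) (auto simp: mult_left_le)
  finally show ?thesis by simp
qed

section \<open>Probability generating functions of the stationary process\<close>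

locale stable_inar1 = stationary_inar1 +
  assumes pos_scale: "0 < \<delta>" and pos_exponent: "0 < \<alpha>"
    and pos_thinning: "0 < p" and thinning_less_1: "p < 1"
begin

lemma measurable_process [measurable]: "Z t \<in> measurable M (count_space UNIV)"
  using stationary by (simp add: strictly_stationary_def)

lemma measurable_innovation [measurable]: "\<epsilon> t \<in> measurable M (count_space UNIV)"
  using stable_innovations by (simp add: discrete_stable_def)

lemma measurable_thinning_var:
  assumes "1 \<le> i" shows "Y i t \<in> measurable M (count_space UNIV)"
  using assms iid_thinning by (auto simp: iid_vars_def indep_vars_def)

lemma expectation_innovation:
  "norm (x :: complex) \<le> 1 \<Longrightarrow> (LINT w|M. x ^ \<epsilon> t w) = exp (- of_real \<delta> * (1 - x) powr of_real \<alpha>)"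
  using stable_innovations by (simp add: discrete_stable_def)

lemma expectation_thinning_var:
  fixes x :: complex
  assumes "1 \<le> i" shows "(LINT w|M. x ^ Y i t w) = 1 - of_real p * (1 - x)"
proof -
  have "(LINT w|M. x ^ Y i t w) = (LINT n|distr M (count_space UNIV) (Y i t). x ^ n)"
    by (rule integral_distr[symmetric]) (use measurable_thinning_var[OF assms] in auto)
  also have "\<dots> = (LINT b|measure_pmf (bernoulli_pmf p). x ^ of_bool b)"
    using assms by (simp add: bernoulli_thinning)
  also have "\<dots> = 1 - of_real p * (1 - x)"
    using pos_thinning thinning_less_1
    by (subst integral_measure_pmf[of UNIV]) (auto simp: UNIV_bool scaleR_conv_of_real algebra_simps)
  finally show ?thesis .
qed

lemma expectation_prod_thinning_vars:
  fixes x :: complex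
  assumes "norm x \<le> 1"
  shows "(LINT w|M. (\<Prod>i\<in>{1..n}. x ^ Y i t w)) = (1 - of_real p * (1 - x)) ^ n"
proof -
  have "indep_vars (\<lambda>_. count_space UNIV) (\<lambda>(i, t). Y i t) ({1..n} \<times> {t})"
    by (rule indep_vars_subset[of _ _ "{1..} \<times> UNIV"]) (use iid_thinning in \<open>auto simp: iid_vars_def\<close>)
  then have ind: "indep_vars (\<lambda>_. borel) (\<lambda>k w. x ^ (case k of (i, t) \<Rightarrow> Y i t) w) ({1..n} \<times> {t})"
    by (rule indep_vars_compose2) simp
  have "(LINT w|M. (\<Prod>k\<in>{1..n} \<times> {t}. x ^ (case k of (i, t) \<Rightarrow> Y i t) w))
      = (\<Prod>k\<in>{1..n} \<times> {t}. LINT w|M. x ^ (case k of (i, t) \<Rightarrow> Y i t) w)"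
  proof (rule indep_vars_lebesgue_integral[OF _ ind])
    fix k assume "k \<in> {1..n} \<times> {t}"
    then have [measurable]: "(case k of (i, t) \<Rightarrow> Y i t) \<in> measurable M (count_space UNIV)"
      using measurable_thinning_var by auto
    show "integrable M (\<lambda>w. x ^ (case k of (i, t) \<Rightarrow> Y i t) w)"
      by (rule integrable_const_bound[of _ 1]) (auto simp: norm_power assms power_le_one)
  qed auto
  moreover have "(\<Prod>k\<in>{1..n} \<times> {t}. h k) = (\<Prod>i\<in>{1..n}. h (i, t))" for h :: "nat \<times> int \<Rightarrow> complex"
    by (rule prod.reindex_bij_witness[of _ "\<lambda>i. (i, t)" fst]) auto
  ultimately show ?thesis
    by (simp add: expectation_thinning_var)
qed

lemma expectation_innovation_thinning:
  fixes x :: complex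
  assumes x: "norm x \<le> 1"
  shows "(LINT w|M. x ^ \<epsilon> t w * (\<Prod>i\<in>{1..n}. x ^ Y i s w))
    = exp (- of_real \<delta> * (1 - x) powr of_real \<alpha>) * (1 - of_real p * (1 - x)) ^ n"
proof -
  have "(LINT w|M. (\<lambda>y. \<Prod>i\<in>{1..n}. x ^ y (i, s)) (\<lambda>(i, t)\<in>{1..} \<times> UNIV. Y i t w) * (\<lambda>e. x ^ e t) (\<lambda>t. \<epsilon> t w))
    = (LINT w|M. (\<lambda>y. \<Prod>i\<in>{1..n}. x ^ y (i, s)) (\<lambda>(i, t)\<in>{1..} \<times> UNIV. Y i t w)) * (LINT w|M. (\<lambda>e. x ^ e t) (\<lambda>t. \<epsilon> t w))"
  proof (rule indep_rvs_expectation_mult[OF indep_thinning_innovations])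
    show "(\<lambda>y. \<Prod>i\<in>{1..n}. x ^ y (i, s)) \<in> borel_measurable (\<Pi>\<^sub>M _\<in>{1..} \<times> UNIV. count_space UNIV)"
      by (intro borel_measurable_prod measurable_compose[OF measurable_component_singleton]) auto
    show "(\<lambda>e. x ^ e t) \<in> borel_measurable (\<Pi>\<^sub>M _\<in>UNIV. count_space UNIV)"
      by (intro measurable_compose[OF measurable_component_singleton]) auto
  qed (auto simp: norm_power prod_norm[symmetric] intro!: prod_le_1 power_le_one x)
  moreover have "(\<Prod>i\<in>{1..n}. x ^ (\<lambda>(i, t)\<in>{1..} \<times> UNIV. Y i t w) (i, s)) = (\<Prod>i\<in>{1..n}. x ^ Y i s w)" for w
    by (rule prod.cong) auto
  ultimately show ?thesis
    using expectation_prod_thinning_vars[OF x] expectation_innovation[OF x] by (simp add: mult.commute)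
qed

text \<open>
  On the event \<open>Z (t - 1) = n\<close> the random thinning sum becomes a sum of the first \<open>n\<close> Bernoulli
  variables. There \<open>x ^ Z t\<close> depends only on the innovation and these variables, while the remaining
  factors depend on the past only, so the expectation factorises; summing over \<open>n\<close> reassembles the
  power \<open>Z (t - 1)\<close>. The factor \<open>y ^ Z s\<close> rides along, so that the same step serves the marginal
  and the joint generating functions.
\<close>

lemma one_step_pgf:
  fixes x y :: complex
  assumes x: "norm x \<le> 1" and y: "norm y \<le> 1" and st: "s < t"
  shows "(LINT w|M. x ^ Z t w * y ^ Z s w)
    = exp (- of_real \<delta> * (1 - x) powr of_real \<alpha>)
      * (LINT w|M. (1 - of_real p * (1 - x)) ^ Z (t - 1) w * y ^ Z s w)" (is "_ = ?\<phi> * _")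
proof -
  let ?q = "1 - of_real p * (1 - x) :: complex"
  have q: "norm ?q \<le> 1"
    using norm_affine_towards_1[OF _ _ x, of p] pos_thinning thinning_less_1 by simp
  \<comment> \<open>the contribution of the event \<open>Z (t - 1) = n\<close>\<close>
  have term_eq: "(LINT w|M. of_bool (Z (t - 1) w = n) * (x ^ Z t w * y ^ Z s w))
      = ?\<phi> * (LINT w|M. of_bool (Z (t - 1) w = n) * (?q ^ Z (t - 1) w * y ^ Z s w))" for n
  proof -
    let ?f = "\<lambda>(e, a). x ^ e * (\<Prod>i\<in>{1..n}. x ^ a i)"
    let ?g = "\<lambda>z. of_bool (z (t - 1) = n) * y ^ z s"
    let ?U = "\<lambda>w. (\<epsilon> t w, \<lambda>i\<in>{1..}. Y i (t - 1) w)" and ?V = "\<lambda>w. \<lambda>s\<in>{..t - 1}. Z s w"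
    have U: "?f (?U w) = x ^ \<epsilon> t w * (\<Prod>i\<in>{1..n}. x ^ Y i (t - 1) w)" for w
      by (auto intro!: prod.cong)
    have V: "?g (?V w) = of_bool (Z (t - 1) w = n) * y ^ Z s w" for w
      using st by simp
    have f [measurable]: "?f \<in> borel_measurable (count_space UNIV \<Otimes>\<^sub>M (\<Pi>\<^sub>M _\<in>{1..}. count_space UNIV))"
      unfolding split_beta
      by (intro borel_measurable_times borel_measurable_prod
          measurable_compose[OF measurable_compose[OF measurable_snd measurable_component_singleton]]
          measurable_compose[OF measurable_fst]) auto
    have g [measurable]: "?g \<in> borel_measurable (\<Pi>\<^sub>M _\<in>{..t - 1}. count_space UNIV)"
      by (intro borel_measurable_times measurable_compose[OF measurable_component_singleton, where g="\<lambda>z. of_bool (z = n)"]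
          measurable_compose[OF measurable_component_singleton, where g="\<lambda>z. y ^ z"]) (use st in auto)
    have "(LINT w|M. of_bool (Z (t - 1) w = n) * (x ^ Z t w * y ^ Z s w))
        = (LINT w|M. ?f (?U w) * ?g (?V w))"
    proof (rule integral_cong_AE)
      have "?U \<in> measurable M (count_space UNIV \<Otimes>\<^sub>M (\<Pi>\<^sub>M _\<in>{1..}. count_space UNIV))"
        and "?V \<in> measurable M (\<Pi>\<^sub>M _\<in>{..t - 1}. count_space UNIV)"
        using indep_past[of t] by (auto simp: indep_rvs_def)
      then show "(\<lambda>w. ?f (?U w) * ?g (?V w)) \<in> borel_measurable M"
        by (intro borel_measurable_times measurable_compose[OF _ f] measurable_compose[OF _ g])
      show "AE w in M. of_bool (Z (t - 1) w = n) * (x ^ Z t w * y ^ Z s w) = ?f (?U w) * ?g (?V w)"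
        using recursion[of t]
      proof eventually_elim
        case (elim w)
        then show ?case
          unfolding U V by (auto simp: thinning_def power_add power_sum)
      qed
    qed simp
    also have "\<dots> = (LINT w|M. ?f (?U w)) * (LINT w|M. ?g (?V w))"
      by (rule indep_rvs_expectation_mult[OF indep_past f g])
        (auto simp: norm_mult norm_power prod_norm[symmetric] x y intro!: mult_le_one prod_le_1 power_le_one prod_nonneg)
    also have "\<dots> = ?\<phi> * (?q ^ n * (LINT w|M. of_bool (Z (t - 1) w = n) * y ^ Z s w))"
      unfolding U V expectation_innovation_thinning[OF x] by (simp add: mult.assoc)
    also have "?q ^ n * (LINT w|M. of_bool (Z (t - 1) w = n) * y ^ Z s w)
        = (LINT w|M. of_bool (Z (t - 1) w = n) * (?q ^ Z (t - 1) w * y ^ Z s w))"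
      unfolding integral_mult_right_zero[symmetric] by (intro Bochner_Integration.integral_cong) auto
    finally show ?thesis .
  qed
  have "(\<lambda>n. LINT w|M. of_bool (Z (t - 1) w = n) * (x ^ Z t w * y ^ Z s w)) sums (LINT w|M. x ^ Z t w * y ^ Z s w)"
    by (rule expectation_sums_over_values) (auto simp: norm_mult norm_power x y intro!: mult_le_one power_le_one)
  moreover have "(\<lambda>n. ?\<phi> * (LINT w|M. of_bool (Z (t - 1) w = n) * (?q ^ Z (t - 1) w * y ^ Z s w)))
      sums (?\<phi> * (LINT w|M. ?q ^ Z (t - 1) w * y ^ Z s w))"
    by (intro sums_mult expectation_sums_over_values) (auto simp: norm_mult norm_power q y intro!: mult_le_one power_le_one)
  ultimately show ?thesis
    unfolding term_eq by (rule sums_unique2)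
qed

end

section \<open>Summability and Fourier coefficients\<close>

text \<open>
  The difference quotient of \<open>g\<close> at \<open>0\<close> is bounded along \<open>r ^ n\<close>, so the increments are dominated by
  a geometric series.
\<close>

lemma summable_norm_geometric_increments:
  fixes g :: "complex \<Rightarrow> complex" and r :: complex
  assumes g: "g field_differentiable (at 0)" and r: "norm r < 1" "r \<noteq> 0"
  shows "summable (\<lambda>n. norm (g (r ^ n) - g 0))"
proof -
  obtain D where D: "(g has_field_derivative D) (at 0)"
    using g by (auto simp: field_differentiable_def)
  have lim: "filterlim (\<lambda>n. r ^ n) (at 0) sequentially"
    using LIMSEQ_power_zero[OF r(1)] r(2) by (simp add: filterlim_at)
  have "(\<lambda>n. (g (r ^ n) - g 0) / r ^ n) \<longlonglongrightarrow> D"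
    using filterlim_compose[OF D[unfolded DERIV_def] lim] by simp
  then have "(\<lambda>n. g (r ^ n) - g 0) \<in> O(\<lambda>n. r ^ n)"
    by (rule bigoI_tendsto) (use r in auto)
  then have "(\<lambda>n. norm (g (r ^ n) - g 0)) \<in> O(\<lambda>n. norm (r ^ n))"
    by (subst landau_o.big.norm_iff)
  then show ?thesis
    by (rule summable_comparison_test_bigo[rotated])
      (use r in \<open>simp add: norm_power summable_geometric\<close>)
qed

lemma summable_norm_mult_increments:
  fixes a b :: "nat \<Rightarrow> complex"
  assumes a: "summable (\<lambda>n. norm (a n - a0))" and b: "summable (\<lambda>n. norm (b n - b0))"
  shows "summable (\<lambda>n. norm (a n * b n - a0 * b0))"
proof -
  have "(\<lambda>n. b n - b0) \<longlonglongrightarrow> 0"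
    using summable_LIMSEQ_zero[OF b] by (simp add: tendsto_norm_zero_iff)
  then have "b \<longlonglongrightarrow> b0"
    by (simp add: LIM_zero_iff)
  then obtain K where K: "norm (b n) \<le> K" for n
    by (meson Bseq_def convergentI convergent_imp_Bseq)
  have "norm (a n * b n - a0 * b0) \<le> K * norm (a n - a0) + norm a0 * norm (b n - b0)" for n
  proof -
    have "norm (a n * b n - a0 * b0) = norm ((a n - a0) * b n + a0 * (b n - b0))"
      by (simp add: algebra_simps)
    also have "\<dots> \<le> norm (a n - a0) * norm (b n) + norm a0 * norm (b n - b0)"
      by (intro order.trans[OF norm_triangle_ineq]) (simp add: norm_mult)
    also have "norm (a n - a0) * norm (b n) \<le> norm (a n - a0) * K"
      by (intro mult_left_mono K) auto
    finally show ?thesis by (simp add: mult.commute)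
  qed
  then show ?thesis
    by (intro summable_comparison_test'[OF summable_add[OF summable_mult[OF a, of K] summable_mult[OF b, of "norm a0"]], of 0]) auto
qed

lemma summable_on_int_norm:
  fixes c :: "int \<Rightarrow> complex"
  assumes "summable (\<lambda>n. norm (c (int n)))" "summable (\<lambda>n. norm (c (- int n)))"
  shows "(\<lambda>l. norm (c l)) summable_on UNIV"
proof -
  have "(\<lambda>l. norm (c l)) summable_on range int"
    by (subst summable_on_reindex)
      (use assms(1) in \<open>auto simp: comp_def intro!: norm_summable_imp_summable_on\<close>)
  moreover have "(\<lambda>l. norm (c l)) summable_on range (\<lambda>n. - int (Suc n))"
    by (subst summable_on_reindex)
      (use assms(2) summable_Suc_iff[of "\<lambda>n. norm (c (- int n))"]
        in \<open>auto simp: comp_def inj_def intro!: norm_summable_imp_summable_on\<close>)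
  ultimately have "(\<lambda>l. norm (c l)) summable_on (range int \<union> range (\<lambda>n. - int (Suc n)))"
    by (rule summable_on_Un_disjoint) auto
  also have "range int \<union> range (\<lambda>n. - int (Suc n)) = UNIV"
  proof -
    have "x \<in> range int \<union> range (\<lambda>n. - int (Suc n))" for x
      by (cases x rule: int_cases) blast+
    then show ?thesis by blast
  qed
  finally show ?thesis .
qed

lemma has_integral_exp_int_period:
  fixes m :: int
  shows "((\<lambda>t. exp (\<i> * of_int m * of_real t)) has_integral (if m = 0 then of_real (2 * pi) else 0)) {0..2 * pi}"
proof (cases "m = 0")
  case True
  then show ?thesis
    using has_integral_const_real[of "1 :: complex" 0 "2 * pi"] by (simp add: scaleR_conv_of_real)
next
  case False
  let ?F = "\<lambda>t::real. exp (\<i> * of_int m * of_real t) / (\<i> * of_int m)"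
  have "((\<lambda>t. exp (\<i> * of_int m * of_real t)) has_integral (?F (2 * pi) - ?F 0)) {0..2 * pi}"
    by (rule fundamental_theorem_of_calculus)
      (use False in \<open>auto intro!: derivative_eq_intros has_vector_derivative_real_field\<close>)
  moreover have "exp (\<i> * of_int m * of_real (2 * pi)) = 1"
    by (rule exp_eq_1[THEN iffD2]) (auto intro!: exI[of _ m])
  ultimately show ?thesis using False by simp
qed

text \<open>
  Absolute summability makes the series converge uniformly in \<open>t\<close>, so the integral may be taken term
  by term and orthogonality of the exponentials leaves the term with index \<open>k\<close>.
\<close>

lemma has_integral_fourier_coefficient:
  fixes c :: "int \<Rightarrow> complex"
  assumes c: "(\<lambda>l. norm (c l)) summable_on UNIV"
  shows "((\<lambda>t. (\<Sum>\<^sub>\<infinity>l\<in>UNIV. c l * exp (- \<i> * of_int l * of_real t)) * exp (\<i> * of_int k * of_real t))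
    has_integral of_real (2 * pi) * c k) {0..2 * pi}"
proof -
  let ?h = "\<lambda>l t. c l * exp (- \<i> * of_int l * of_real t) * exp (\<i> * of_int k * of_real t)"
  have h: "?h l t = c l * exp (\<i> * of_int (k - l) * of_real t)" for l :: int and t :: real
    by (simp add: mult.assoc exp_add[symmetric] algebra_simps)
  have "uniform_limit {0..2 * pi} (\<lambda>F t. \<Sum>l\<in>F. ?h l t) (\<lambda>t. \<Sum>\<^sub>\<infinity>l\<in>UNIV. ?h l t) (finite_subsets_at_top UNIV)"
    by (rule Weierstrass_m_test_general[OF _ c]) (simp add: norm_mult)
  moreover have "continuous_on {0..2 * pi} (\<lambda>t. \<Sum>l\<in>F. ?h l t)" for F
    by (intro continuous_intros)
  ultimately obtain I J where I: "\<And>F. ((\<lambda>t. \<Sum>l\<in>F. ?h l t) has_integral I F) {0..2 * pi}"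
    and J: "((\<lambda>t. \<Sum>\<^sub>\<infinity>l\<in>UNIV. ?h l t) has_integral J) {0..2 * pi}"
    and lim: "(I \<longlongrightarrow> J) (finite_subsets_at_top UNIV)"
    by (rule uniform_limit_integral[OF _ _ finite_subsets_at_top_neq_bot]) auto
  have "I F = of_real (2 * pi) * c k" if "finite F" "k \<in> F" for F
  proof -
    have "((\<lambda>t. \<Sum>l\<in>F. ?h l t) has_integral (\<Sum>l\<in>F. c l * (if k - l = 0 then of_real (2 * pi) else 0))) {0..2 * pi}"
      unfolding h by (intro has_integral_sum[OF that(1)] has_integral_mult_right has_integral_exp_int_period)
    then have "I F = (\<Sum>l\<in>F. c l * (if k - l = 0 then of_real (2 * pi) else 0))"
      by (rule has_integral_unique[OF I])
    also have "\<dots> = (\<Sum>l\<in>F. if l = k then of_real (2 * pi) * c k else 0)"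
      by (rule sum.cong) auto
    finally show ?thesis using that by simp
  qed
  then have "eventually (\<lambda>F. I F = of_real (2 * pi) * c k) (finite_subsets_at_top UNIV)"
    by (auto simp: eventually_finite_subsets_at_top intro!: exI[of _ "{k}"])
  then have "(I \<longlongrightarrow> of_real (2 * pi) * c k) (finite_subsets_at_top UNIV)"
    by (rule tendsto_eventually)
  then have "J = of_real (2 * pi) * c k"
    using lim by (intro tendsto_unique[OF finite_subsets_at_top_neq_bot])
  then show ?thesis
    using J by (simp add: infsum_cmult_left')
qed

text \<open>
  The Fourier coefficients of the generalized spectrum up to the factor \<open>1 / (2 * pi)\<close>, again with
  reference time 0.
\<close>

definition generalized_autocovariance ::
  "'a measure \<Rightarrow> (int \<Rightarrow> 'a \<Rightarrow> real) \<Rightarrow> int \<Rightarrow> real \<Rightarrow> real \<Rightarrow> complex" where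
  "generalized_autocovariance M Z l u v =
     (LINT w|M. exp (\<i> * of_real u * of_real (Z l w) + \<i> * of_real v * of_real (Z 0 w)))
       - (LINT w|M. exp (\<i> * of_real u * of_real (Z l w)))
         * (LINT w|M. exp (\<i> * of_real v * of_real (Z 0 w)))"

lemma generalized_autocovariance_eqI:
  assumes "(\<lambda>l. norm (generalized_autocovariance M Z l u v)) summable_on UNIV"
    and "(\<lambda>l. norm (generalized_autocovariance M' Z' l u v)) summable_on UNIV"
    and "\<And>lam. lam \<in> {0..2 * pi} \<Longrightarrow> generalized_spectrum M Z lam u v = generalized_spectrum M' Z' lam u v"
  shows "generalized_autocovariance M Z l u v = generalized_autocovariance M' Z' l u v"
proof -
  let ?S = "\<lambda>c lam. \<Sum>\<^sub>\<infinity>l\<in>UNIV. c l * exp (- \<i> * of_int l * of_real lam)"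
  have "?S (\<lambda>l. generalized_autocovariance M Z l u v) lam = ?S (\<lambda>l. generalized_autocovariance M' Z' l u v) lam"
    if "lam \<in> {0..2 * pi}" for lam
    using assms(3)[OF that] by (simp add: generalized_spectrum_def generalized_autocovariance_def)
  then have "((\<lambda>t. ?S (\<lambda>l. generalized_autocovariance M Z l u v) t * exp (\<i> * of_int l * of_real t))
      has_integral of_real (2 * pi) * generalized_autocovariance M' Z' l u v) {0..2 * pi}"
    by (intro has_integral_eq[OF _ has_integral_fourier_coefficient[OF assms(2)]]) auto
  from has_integral_unique[OF has_integral_fourier_coefficient[OF assms(1)] this]
  show ?thesis by simp
qed

section \<open>Generalized autocovariances in closed form\<close>

lemma exp_ii_mult_nat: "exp (\<i> * of_real a * of_real (real n)) = cis a ^ n"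
  by (simp add: cis_conv_exp exp_of_nat_mult[symmetric] mult_ac)

context stable_inar1
begin

definition "\<rho> = p powr \<alpha>"

text \<open>The scale of the stationary law.\<close>

definition "\<kappa> = \<delta> / (1 - \<rho>)"

lemma rho_bounds: "0 < \<rho>" "\<rho> < 1"
  using pos_thinning thinning_less_1 pos_exponent by (auto simp: \<rho>_def powr01_less_one)

lemma kappa_pos: "0 < \<kappa>"
  using rho_bounds pos_scale by (simp add: \<kappa>_def)

text \<open>
  The \<open>l\<close> steps contribute scales \<open>\<delta> * \<rho> ^ k\<close> for \<open>k < l\<close>, whose sum is \<open>\<kappa> * (1 - \<rho> ^ l)\<close>.
\<close>

lemma joint_pgf_reduction:
  fixes x y :: complex
  assumes "norm x \<le> 1" and y: "norm y \<le> 1"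
  shows "(LINT w|M. x ^ Z (s + int l) w * y ^ Z s w)
    = exp (- of_real (\<kappa> * (1 - \<rho> ^ l)) * (1 - x) powr of_real \<alpha>)
      * (LINT w|M. (1 - of_real (p ^ l) * (1 - x)) ^ Z s w * y ^ Z s w)"
  using assms(1)
proof (induction l arbitrary: x)
  case 0
  then show ?case by simp
next
  case (Suc l)
  let ?x = "1 - of_real p * (1 - x)"
  have x': "norm ?x \<le> 1"
    using norm_affine_towards_1[OF _ _ Suc.prems, of p] pos_thinning thinning_less_1 by simp
  \<comment> \<open>pulling out a positive real factor does not cross the branch cut\<close>
  have scale: "(1 - ?x) powr of_real \<alpha> = of_real \<rho> * (1 - x) powr of_real \<alpha>"
  proof -
    have "1 - ?x = of_real p * (1 - x)" by simp
    then show ?thesis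
      using pos_thinning by (simp only:) (subst powr_times_real_left, auto simp: powr_of_real \<rho>_def)
  qed
  have kap: "\<kappa> * (1 - \<rho>) = \<delta>"
    using rho_bounds by (simp add: \<kappa>_def)
  have "(LINT w|M. x ^ Z (s + int (Suc l)) w * y ^ Z s w)
      = exp (- of_real \<delta> * (1 - x) powr of_real \<alpha>) * (LINT w|M. ?x ^ Z (s + int l) w * y ^ Z s w)"
    using one_step_pgf[OF Suc.prems y, of s "s + int (Suc l)"] by (simp add: add_ac)
  also have "\<dots> = exp (- of_real \<delta> * (1 - x) powr of_real \<alpha>)
      * exp (- of_real (\<kappa> * (1 - \<rho> ^ l)) * (1 - ?x) powr of_real \<alpha>)
      * (LINT w|M. (1 - of_real (p ^ l) * (1 - ?x)) ^ Z s w * y ^ Z s w)"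
    unfolding Suc.IH[OF x'] by (simp add: mult.assoc)
  also have "exp (- of_real \<delta> * (1 - x) powr of_real \<alpha>)
      * exp (- of_real (\<kappa> * (1 - \<rho> ^ l)) * (1 - ?x) powr of_real \<alpha>)
      = exp (- of_real (\<kappa> * (1 - \<rho> ^ Suc l)) * (1 - x) powr of_real \<alpha>)"
  proof -
    have "\<kappa> * (1 - \<rho>) + \<kappa> * (1 - \<rho> ^ l) * \<rho> = \<kappa> * (1 - \<rho> ^ Suc l)"
      by (simp add: algebra_simps)
    then have sum: "\<delta> + \<kappa> * (1 - \<rho> ^ l) * \<rho> = \<kappa> * (1 - \<rho> ^ Suc l)"
      unfolding kap .
    have "- of_real \<delta> * c + - of_real (\<kappa> * (1 - \<rho> ^ l)) * (of_real \<rho> * c)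
        = - of_real (\<kappa> * (1 - \<rho> ^ Suc l)) * c" for c :: complex
      unfolding sum[symmetric] by (simp add: algebra_simps)
    then show ?thesis
      unfolding exp_add[symmetric] scale by (rule arg_cong)
  qed
  also have "1 - of_real (p ^ l) * (1 - ?x) = 1 - of_real (p ^ Suc l) * (1 - x)"
    by simp
  finally show ?case .
qed

lemma expectation_shift:
  fixes x y :: complex
  shows "(LINT w|M. x ^ Z (s + h) w * y ^ Z (t + h) w) = (LINT w|M. x ^ Z s w * y ^ Z t w)"
proof -
  let ?P = "\<Pi>\<^sub>M t\<in>{s, t}. (count_space UNIV :: nat measure)"
  have [measurable]: "(\<lambda>z. x ^ z s * y ^ z t) \<in> borel_measurable ?P"
    by (intro borel_measurable_times measurable_compose[OF measurable_component_singleton]) auto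
  have [measurable]: "(\<lambda>w. \<lambda>r\<in>{s, t}. Z (r + k) w) \<in> measurable M ?P" for k
    by (intro measurable_restrict) auto
  have *: "(LINT w|M. x ^ Z (s + k) w * y ^ Z (t + k) w)
      = (LINT z|distr M ?P (\<lambda>w. \<lambda>r\<in>{s, t}. Z (r + k) w). x ^ z s * y ^ z t)" for k
    by (subst integral_distr) auto
  have "distr M ?P (\<lambda>w. \<lambda>r\<in>{s, t}. Z (r + h) w) = distr M ?P (\<lambda>w. \<lambda>r\<in>{s, t}. Z r w)"
    using stationary by (auto simp: strictly_stationary_def)
  then show ?thesis
    using *[of h] *[of 0] by simp
qed

text \<open>
  By stationarity the left-hand side of the \<open>l\<close>-step reduction is independent of \<open>l\<close>. Its variable
  \<open>1 - p ^ l * (1 - x)\<close> tends to \<open>1\<close>, where every generating function is continuous with value \<open>1\<close>.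
\<close>

lemma expectation_pgf:
  fixes x :: complex
  assumes x: "norm x \<le> 1"
  shows "(LINT w|M. x ^ Z t w) = exp (- of_real \<kappa> * (1 - x) powr of_real \<alpha>)"
proof -
  let ?c = "(1 - x) powr of_real \<alpha>" and ?q = "\<lambda>l. 1 - of_real (p ^ l) * (1 - x)"
  have q1: "norm (?q l) \<le> 1" for l
    by (rule norm_affine_towards_1) (use pos_thinning thinning_less_1 x in \<open>auto intro: power_le_one\<close>)
  have rec: "(LINT w|M. x ^ Z t w) = exp (- of_real (\<kappa> * (1 - \<rho> ^ l)) * ?c) * (LINT w|M. ?q l ^ Z t w)" for l
    using joint_pgf_reduction[OF x, of 1 t l] expectation_shift[of x t "int l" 1 t] by simp
  have "(\<lambda>l. \<rho> ^ l) \<longlonglongrightarrow> 0" "(\<lambda>l. p ^ l) \<longlonglongrightarrow> 0"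
    using rho_bounds pos_thinning thinning_less_1 by (auto intro!: LIMSEQ_power_zero)
  note lims = tendsto_of_real[OF this(1), where 'a=complex] tendsto_of_real[OF this(2), where 'a=complex]
  have "(\<lambda>l. LINT w|M. ?q l ^ Z t w) \<longlonglongrightarrow> (LINT w|M. 1)"
  proof (rule integral_dominated_convergence[where w = "\<lambda>_. 1"])
    have "(\<lambda>l. ?q l ^ n) \<longlonglongrightarrow> (1 - of_real 0 * (1 - x)) ^ n" for n
      by (intro tendsto_intros lims)
    then show "AE w in M. (\<lambda>l. ?q l ^ Z t w) \<longlonglongrightarrow> 1" by simp
    show "AE w in M. norm (?q l ^ Z t w) \<le> 1" for l
      using q1[of l] by (auto simp: norm_power intro!: power_le_one)
  qed auto
  moreover have "(\<lambda>l. exp (- (of_real \<kappa> * (1 - of_real (\<rho> ^ l))) * ?c)) \<longlonglongrightarrow> exp (- (of_real \<kappa> * (1 - of_real 0)) * ?c)"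
    by (intro tendsto_intros lims)
  ultimately have "(\<lambda>l. exp (- (of_real \<kappa> * (1 - of_real (\<rho> ^ l))) * ?c) * (LINT w|M. ?q l ^ Z t w))
      \<longlonglongrightarrow> exp (- (of_real \<kappa> * (1 - of_real 0)) * ?c) * (LINT w|M. 1)"
    by (rule tendsto_mult[rotated])
  moreover have "exp (- (of_real \<kappa> * (1 - of_real (\<rho> ^ l))) * ?c) * (LINT w|M. ?q l ^ Z t w) = (LINT w|M. x ^ Z t w)" for l
    unfolding rec[of l] by simp
  ultimately show ?thesis
    by (simp add: LIMSEQ_const_iff prob_space)
qed

lemma expectation_joint_pgf:
  fixes x y :: complex
  assumes x: "norm x \<le> 1" and y: "norm y \<le> 1"
  shows "(LINT w|M. x ^ Z (s + int l) w * y ^ Z s w)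
    = exp (- of_real (\<kappa> * (1 - \<rho> ^ l)) * (1 - x) powr of_real \<alpha>)
      * exp (- of_real \<kappa> * (1 - y + y * of_real (p ^ l) * (1 - x)) powr of_real \<alpha>)"
proof -
  let ?q = "1 - of_real (p ^ l) * (1 - x)"
  have "norm ?q \<le> 1"
    by (rule norm_affine_towards_1) (use pos_thinning thinning_less_1 x in \<open>auto intro: power_le_one\<close>)
  then have "norm (?q * y) \<le> 1"
    using y by (simp add: norm_mult mult_le_one)
  from expectation_pgf[OF this, of s] have "(LINT w|M. ?q ^ Z s w * y ^ Z s w)
      = exp (- of_real \<kappa> * (1 - ?q * y) powr of_real \<alpha>)"
    by (simp add: power_mult_distrib)
  also have "1 - ?q * y = 1 - y + y * of_real (p ^ l) * (1 - x)"
    by (simp add: algebra_simps)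
  finally show ?thesis
    unfolding joint_pgf_reduction[OF x y] by (rule arg_cong)
qed

lemma generalized_autocovariance_nonneg_lag:
  fixes u v :: real
  defines "x \<equiv> cis u" and "y \<equiv> cis v"
  shows "generalized_autocovariance M (\<lambda>t w. real (Z t w)) (int l) u v
    = exp (- of_real (\<kappa> * (1 - \<rho> ^ l)) * (1 - x) powr of_real \<alpha>)
        * exp (- of_real \<kappa> * (1 - y + y * of_real (p ^ l) * (1 - x)) powr of_real \<alpha>)
      - exp (- of_real \<kappa> * (1 - x) powr of_real \<alpha>) * exp (- of_real \<kappa> * (1 - y) powr of_real \<alpha>)"
proof -
  have n: "norm x \<le> 1" "norm y \<le> 1" by (auto simp: x_def y_def)
  show ?thesis
    using expectation_joint_pgf[OF n, of 0 l] expectation_pgf[OF n(1)] expectation_pgf[OF n(2)]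
    unfolding generalized_autocovariance_def exp_add exp_ii_mult_nat x_def y_def by simp
qed

lemma generalized_autocovariance_uminus:
  "generalized_autocovariance M (\<lambda>t w. real (Z t w)) (- l) u v
   = generalized_autocovariance M (\<lambda>t w. real (Z t w)) l v u"
  using expectation_shift[of "cis u" "- l" l "cis v" 0]
  unfolding generalized_autocovariance_def exp_add exp_ii_mult_nat
  by (simp add: expectation_pgf mult.commute)

text \<open>
  The lag \<open>l\<close> enters only through \<open>\<rho> ^ l\<close> and \<open>p ^ l\<close>. Replacing both by \<open>0\<close> gives the product of the
  marginals, and for \<open>cis v \<noteq> 1\<close> the base \<open>1 - cis v\<close> of the power lies off the branch cut, so the
  dependence on both quantities is differentiable there.
\<close>

lemma summable_autocovariance_nonneg_lags:
  assumes v: "cis v \<noteq> 1"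
  shows "summable (\<lambda>l. norm (generalized_autocovariance M (\<lambda>t w. real (Z t w)) (int l) u v))"
proof -
  let ?x = "cis u" and ?y = "cis v"
  let ?a = "(1 - ?x) powr of_real \<alpha>"
  let ?A = "\<lambda>h. exp (- (of_real \<kappa> * (1 - h)) * ?a)"
  let ?B = "\<lambda>h. exp (- of_real \<kappa> * (1 - ?y + ?y * h * (1 - ?x)) powr of_real \<alpha>)"
  have "cos v \<noteq> 1"
  proof
    assume "cos v = 1"
    moreover from this have "sin v = 0" using sin_cos_squared_add[of v] by simp
    ultimately show False using v by (simp add: complex_eq_iff)
  qed
  then have "cos v < 1" using cos_le_one[of v] by linarith
  then have "1 - ?y \<notin> \<real>\<^sub>\<le>\<^sub>0"
    by (auto simp: complex_nonpos_Reals_iff)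
  then have "?B field_differentiable (at 0)"
    unfolding field_differentiable_def by (auto intro!: exI derivative_eq_intros)
  then have "summable (\<lambda>l. norm (?B (of_real p ^ l) - ?B 0))"
    by (rule summable_norm_geometric_increments) (use pos_thinning thinning_less_1 in auto)
  moreover have "?A field_differentiable (at 0)"
    unfolding field_differentiable_def by (auto intro!: exI derivative_eq_intros)
  then have "summable (\<lambda>l. norm (?A (of_real \<rho> ^ l) - ?A 0))"
    by (rule summable_norm_geometric_increments) (use rho_bounds in auto)
  ultimately have "summable (\<lambda>l. norm (?A (of_real \<rho> ^ l) * ?B (of_real p ^ l) - ?A 0 * ?B 0))"
    by (rule summable_norm_mult_increments[rotated])
  then show ?thesis
    unfolding generalized_autocovariance_nonneg_lag by simp
qed

lemma summable_autocovariance: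
  assumes "cis u \<noteq> 1" "cis v \<noteq> 1"
  shows "(\<lambda>l. norm (generalized_autocovariance M (\<lambda>t w. real (Z t w)) l u v)) summable_on UNIV"
proof (rule summable_on_int_norm)
  show "summable (\<lambda>n. norm (generalized_autocovariance M (\<lambda>t w. real (Z t w)) (int n) u v))"
    by (rule summable_autocovariance_nonneg_lags[OF assms(2)])
  show "summable (\<lambda>n. norm (generalized_autocovariance M (\<lambda>t w. real (Z t w)) (- int n) u v))"
    unfolding generalized_autocovariance_uminus
    by (rule summable_autocovariance_nonneg_lags[OF assms(1)])
qed

text \<open>
  At \<open>u = v = \<pi>\<close> both variables are \<open>-1\<close> and every base of a power is a nonnegative real, so the
  exponent can be read off by a real logarithm.
\<close>

lemma autocovariance_pi_pi_lag:
  "generalized_autocovariance M (\<lambda>t w. real (Z t w)) (int l) pi pi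
   = of_real (exp (- (\<kappa> * (1 - \<rho> ^ l) * 2 powr \<alpha> + \<kappa> * (2 * (1 - p ^ l)) powr \<alpha>)) - exp (- (2 * \<kappa> * 2 powr \<alpha>)))"
proof -
  have cis: "1 - cis pi = of_real 2"
    by simp
  have arg: "1 - cis pi + cis pi * of_real (p ^ l) * (1 - cis pi) = of_real (2 * (1 - p ^ l))"
    by (simp add: algebra_simps)
  have "p ^ l \<le> 1"
    using pos_thinning thinning_less_1 by (simp add: power_le_one)
  then have powrs: "(of_real 2 :: complex) powr of_real \<alpha> = of_real (2 powr \<alpha>)"
      "(of_real (2 * (1 - p ^ l)) :: complex) powr of_real \<alpha> = of_real ((2 * (1 - p ^ l)) powr \<alpha>)"
    by (intro powr_of_real; simp)+
  have exps: "exp (- of_real a * of_real b) = (of_real (exp (- (a * b))) :: complex)" for a b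
    by (simp add: exp_of_real[symmetric])
  have sums: "exp (- a) * exp (- b) = exp (- (a + b))" "exp (- a) * exp (- a) = exp (- (2 * a))" for a b :: real
    by (simp_all add: exp_add[symmetric])
  show ?thesis
    unfolding generalized_autocovariance_nonneg_lag arg
    unfolding cis powrs exps of_real_mult[symmetric] of_real_diff[symmetric] sums(2)
    unfolding sums(1) by (simp only: mult.assoc)
qed

text \<open>
  Here \<open>1 - cis (\<pi>/3) = cis (-\<pi>/3)\<close> has modulus \<open>1\<close>, so its power only rotates. With the conjugate
  factor the imaginary parts cancel and a cosine remains.
\<close>

lemma autocovariance_third_pi:
  "generalized_autocovariance M (\<lambda>t w. real (Z t w)) 0 (pi / 3) (- (pi / 3))
   = of_real (1 - exp (- (2 * \<kappa> * cos (\<alpha> * pi / 3))))"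
proof -
  have pw: "cis a powr of_real \<alpha> = cis (\<alpha> * a)" if "- pi < a" "a \<le> pi" for a
  proof -
    have "Ln (cis a) = \<i> * of_real a"
      using that by (simp add: cis_conv_exp)
    then show ?thesis
      by (simp add: powr_def cis_conv_exp mult_ac)
  qed
  have 1: "1 - cis (pi / 3) = cis (- (pi / 3))" "1 - cis (- (pi / 3)) = cis (pi / 3)"
    by (auto simp: complex_eq_iff cos_60)
  have 2: "(1 - cis (pi / 3)) powr of_real \<alpha> = cis (- (\<alpha> * pi / 3))"
      "(1 - cis (- (pi / 3))) powr of_real \<alpha> = cis (\<alpha> * pi / 3)"
    using pw[of "pi / 3"] pw[of "- (pi / 3)"] pi_gt_zero unfolding 1 by simp_all
  have 3: "1 - cis (- (pi / 3)) + cis (- (pi / 3)) * (1 - cis (pi / 3)) = 0"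
    by (simp add: algebra_simps cis_mult)
  have 4: "cis (- (\<alpha> * pi / 3)) + cis (\<alpha> * pi / 3) = of_real (2 * cos (\<alpha> * pi / 3))"
    by (simp add: complex_eq_iff)
  have "exp (- of_real \<kappa> * cis (- (\<alpha> * pi / 3))) * exp (- of_real \<kappa> * cis (\<alpha> * pi / 3))
      = exp (- of_real \<kappa> * (cis (- (\<alpha> * pi / 3)) + cis (\<alpha> * pi / 3)))"
    by (simp add: exp_add[symmetric] algebra_simps)
  also have "\<dots> = of_real (exp (- (2 * \<kappa> * cos (\<alpha> * pi / 3))))"
    unfolding 4 by (simp add: exp_of_real[symmetric] mult_ac)
  finally show ?thesis
    using generalized_autocovariance_nonneg_lag[of 0 "pi / 3" "- (pi / 3)"] 3
    by (simp add: 2)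
qed

end

section \<open>Recovering the parameters\<close>

text \<open>
  The quotient of the two quantities is \<open>cos (a * \<pi>/3) / 2 powr a\<close>: a decreasing numerator over an
  increasing denominator.
\<close>

lemma stable_parameters_eq:
  fixes a a' :: real
  assumes a: "0 < a" "a \<le> 1" "0 < a'" "a' \<le> 1" and k: "0 < k" "0 < k'"
    and e1: "k * 2 powr a = k' * 2 powr a'" and e2: "k * cos (a * pi / 3) = k' * cos (a' * pi / 3)"
  shows "a = a' \<and> k = k'"
proof -
  have less: "cos (b' * pi / 3) * 2 powr b < cos (b * pi / 3) * 2 powr b'"
    if "b < b'" "0 < b" "b' \<le> 1" for b b' :: real
  proof (rule mult_strict_mono')
    have upper: "b' * pi / 3 < pi / 2" and lower: "0 \<le> b' * pi / 3"
      using that pi_gt_zero by (simp_all add: field_simps)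
    show "cos (b' * pi / 3) < cos (b * pi / 3)"
      by (rule cos_monotone_0_pi) (use that upper pi_gt_zero in \<open>auto simp: divide_right_mono\<close>)
    show "0 \<le> cos (b' * pi / 3)"
      by (rule cos_ge_zero) (use upper lower in linarith)+
  qed (use that in auto)
  have "k * (cos (a * pi / 3) * 2 powr a') = (k * cos (a * pi / 3)) * 2 powr a'"
    by (simp only: mult.assoc)
  also have "\<dots> = (k' * 2 powr a') * cos (a' * pi / 3)"
    unfolding e2 by (simp only: mult_ac)
  also have "\<dots> = k * (cos (a' * pi / 3) * 2 powr a)"
    unfolding e1[symmetric] by (simp only: mult_ac)
  finally have "cos (a * pi / 3) * 2 powr a' = cos (a' * pi / 3) * 2 powr a"
    using k by simp
  then have "a = a'"
    using less[of a a'] less[of a' a] a by (cases a a' rule: linorder_cases) auto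
  then show ?thesis using e1 by simp
qed

lemma thinning_parameter_eq:
  fixes a p p' :: real
  assumes a: "0 < a" and p: "0 < p" "p < 1" "0 < p'" "p' < 1"
    and e: "(1 - p) powr a - p powr a = (1 - p') powr a - p' powr a"
  shows "p = p'"
proof -
  have "(1 - r') powr a - r' powr a < (1 - r) powr a - r powr a" if "0 < r" "r < r'" "r' < 1" for r r' :: real
    using powr_less_mono2[OF a, of r r'] powr_less_mono2[OF a, of "1 - r'" "1 - r"] that by simp
  then show ?thesis
    using e p by (cases p p' rule: linorder_cases) fastforce+
qed

theorem lemma8:
  fixes M :: "'a measure" and M' :: "'b measure"
    and \<delta> \<alpha> p \<delta>' \<alpha>' p' :: real
    and Z \<epsilon> :: "int \<Rightarrow> 'a \<Rightarrow> nat" and Y :: "nat \<Rightarrow> int \<Rightarrow> 'a \<Rightarrow> nat"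
    and Z' \<epsilon>' :: "int \<Rightarrow> 'b \<Rightarrow> nat" and Y' :: "nat \<Rightarrow> int \<Rightarrow> 'b \<Rightarrow> nat"
  assumes "\<delta> > 0" and "0 < \<alpha>" and "\<alpha> \<le> 1" and "0 < p" and "p < 1"
    and "\<delta>' > 0" and "0 < \<alpha>'" and "\<alpha>' \<le> 1" and "0 < p'" and "p' < 1"
    and "stationary_inar1 M \<delta> \<alpha> p Z Y \<epsilon>"
    and "stationary_inar1 M' \<delta>' \<alpha>' p' Z' Y' \<epsilon>'"
    and "\<And>lam u v. lam \<in> {0..2 * pi} \<Longrightarrow> u \<in> {-pi..pi} \<Longrightarrow> v \<in> {-pi..pi} \<Longrightarrow>
           generalized_spectrum M (\<lambda>t w. real (Z t w)) lam u v
           = generalized_spectrum M' (\<lambda>t w. real (Z' t w)) lam u v"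
  shows "(\<delta>, \<alpha>, p) = (\<delta>', \<alpha>', p')"
proof -
  interpret A: stable_inar1 M \<delta> \<alpha> p Z Y \<epsilon>
    using assms by (simp add: stable_inar1_def stable_inar1_axioms_def)
  interpret B: stable_inar1 M' \<delta>' \<alpha>' p' Z' Y' \<epsilon>'
    using assms by (simp add: stable_inar1_def stable_inar1_axioms_def)
  have acov: "generalized_autocovariance M (\<lambda>t w. real (Z t w)) l u v
      = generalized_autocovariance M' (\<lambda>t w. real (Z' t w)) l u v"
    if "cis u \<noteq> 1" "cis v \<noteq> 1" "u \<in> {-pi..pi}" "v \<in> {-pi..pi}" for l u v
    using that by (intro generalized_autocovariance_eqI A.summable_autocovariance B.summable_autocovariance assms)
  have pipi: "generalized_autocovariance M (\<lambda>t w. real (Z t w)) (int l) pi pi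
      = generalized_autocovariance M' (\<lambda>t w. real (Z' t w)) (int l) pi pi" for l
    by (rule acov) (auto simp: complex_eq_iff)
  have e1: "A.\<kappa> * 2 powr \<alpha> = B.\<kappa> * 2 powr \<alpha>'"
    using pipi[of 0] unfolding A.autocovariance_pi_pi_lag B.autocovariance_pi_pi_lag of_real_eq_iff
    by simp
  have range: "- (pi / 3) \<le> pi"
    using pi_gt_zero by linarith
  have "generalized_autocovariance M (\<lambda>t w. real (Z t w)) 0 (pi / 3) (- (pi / 3))
      = generalized_autocovariance M' (\<lambda>t w. real (Z' t w)) 0 (pi / 3) (- (pi / 3))"
    by (rule acov) (use range in \<open>auto simp: complex_eq_iff cos_60\<close>)
  then have "A.\<kappa> * cos (\<alpha> * pi / 3) = B.\<kappa> * cos (\<alpha>' * pi / 3)"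
    unfolding A.autocovariance_third_pi B.autocovariance_third_pi of_real_eq_iff by simp
  with e1 have eqs: "\<alpha> = \<alpha>'" "A.\<kappa> = B.\<kappa>"
    using stable_parameters_eq[of \<alpha> \<alpha>' A.\<kappa> B.\<kappa>] assms A.kappa_pos B.kappa_pos by auto
  have split: "(2 * (1 - r)) powr \<alpha> = 2 powr \<alpha> * (1 - r) powr \<alpha>" if "r < 1" for r :: real
    using that powr_mult[of 2 "1 - r" \<alpha>] by simp
  have "A.\<kappa> * (1 - p powr \<alpha>) * 2 powr \<alpha> + A.\<kappa> * (2 * (1 - p)) powr \<alpha>
      = A.\<kappa> * (1 - p' powr \<alpha>) * 2 powr \<alpha> + A.\<kappa> * (2 * (1 - p')) powr \<alpha>"
    using pipi[of 1] unfolding A.autocovariance_pi_pi_lag B.autocovariance_pi_pi_lag of_real_eq_iff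
      eqs(2)[symmetric] A.\<rho>_def B.\<rho>_def
    by (simp add: eqs(1)[symmetric])
  then have "(A.\<kappa> * 2 powr \<alpha>) * ((1 - p) powr \<alpha> - p powr \<alpha>) = (A.\<kappa> * 2 powr \<alpha>) * ((1 - p') powr \<alpha> - p' powr \<alpha>)"
    unfolding split[OF assms(5)] split[OF assms(10)] by (simp add: algebra_simps)
  then have "(1 - p) powr \<alpha> - p powr \<alpha> = (1 - p') powr \<alpha> - p' powr \<alpha>"
    using A.kappa_pos by simp
  then have p: "p = p'"
    using thinning_parameter_eq[of \<alpha> p p'] assms by auto
  have "\<delta> = A.\<kappa> * (1 - A.\<rho>)" "\<delta>' = B.\<kappa> * (1 - B.\<rho>)"
    using A.rho_bounds B.rho_bounds by (auto simp: A.\<kappa>_def B.\<kappa>_def)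
  then show ?thesis
    using eqs p by (simp add: A.\<rho>_def B.\<rho>_def)
qed

end
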